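(* Every simple order type with at most $5$ extreme points is inscribable. That is, if $P\subset\mathbb{R}^2$ is a finite point set with no three collinear points and with at most $5$ extreme points, then there is a finite point set $Q\subset\mathbb{R}^2$ with the same order type as $P$ such that all extreme points of $Q$ lie on a common circle.
   Context: The orientation of an ordered triple of points in the plane is positive if they appear in counterclockwise order around their convex hull, negative if clockwise, and zero if they are collinear. Two finite point sets (configurations) $P,Q\subset\mathbb{R}^2$ have the same order type if there is a bijection between them preserving the orientation of every ordered triple. An order type is an equivalence class of this relation, and an element of the class is said to realize the order type. An order type is simple if it has no collinear triples. The extreme points of a configuration $P$ are the vertices of its convex hull, and the other points of $P$ are its interior points. A configuration is inscribed if all its extreme points lie on a circle. A configuration (or its order type) is inscribable if it has the same order type as some inscribed configuration. *)

theory Defs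
  imports "HOL-Analysis.Analysis"
begin

text \<open>
  The determinant with rows \<open>q - p\<close> and \<open>r - p\<close> is twice the signed area of the triangle
  \<open>p q r\<close>: it is positive, negative or zero according to whether the triple is
  counterclockwise, clockwise or collinear.
\<close>

definition orientation :: "real ^ 2 \<Rightarrow> real ^ 2 \<Rightarrow> real ^ 2 \<Rightarrow> real" where
  "orientation p q r = sgn (det (vector [q - p, r - p] :: real ^ 2 ^ 2))"

text \<open>
  Triples with a repeated point have orientation zero, so letting the quantifiers below range
  over them as well imposes no further condition.
\<close>

definition same_order_type :: "(real ^ 2) set \<Rightarrow> (real ^ 2) set \<Rightarrow> bool" where
  "same_order_type P Q \<longleftrightarrow>
     (\<exists>f. bij_betw f P Q \<and>
          (\<forall>p\<in>P. \<forall>q\<in>P. \<forall>r\<in>P. orientation (f p) (f q) (f r) = orientation p q r))"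

definition simple_configuration :: "(real ^ 2) set \<Rightarrow> bool" where
  "simple_configuration P \<longleftrightarrow>
     (\<forall>p\<in>P. \<forall>q\<in>P. \<forall>r\<in>P. p \<noteq> q \<and> p \<noteq> r \<and> q \<noteq> r \<longrightarrow> \<not> collinear {p, q, r})"

definition extreme_points :: "(real ^ 2) set \<Rightarrow> (real ^ 2) set" where
  "extreme_points P = {x. x extreme_point_of (convex hull P)}"

definition inscribed :: "(real ^ 2) set \<Rightarrow> bool" where
  "inscribed P \<longleftrightarrow> (\<exists>c r. r > 0 \<and> extreme_points P \<subseteq> sphere c r)"

definition inscribable :: "(real ^ 2) set \<Rightarrow> bool" where
  "inscribable P \<longleftrightarrow> (\<exists>Q. finite Q \<and> same_order_type P Q \<and> inscribed Q)"

end

theory Submission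
  imports Defs
begin

text \<open>
  An orientation-preserving projective map whose denominator is positive on the convex hull
  preserves the order type and the extreme points, so it suffices to move the conic through the (at most five) extreme points to a circle.
  Choose extreme points \<open>a b c\<close> such that all other extreme points lie beyond the line \<open>a c\<close>. In
  barycentric coordinates with respect to \<open>a b c\<close>, rescaled by positive weights \<open>k l m\<close>, the map
  \<open>(X : Y : Z) \<mapsto> (X - Z, Y) / (X + Y + Z)\<close> sends \<open>a b c\<close> to \<open>(1, 0)\<close>, \<open>(0, 1)\<close>, \<open>(-1, 0)\<close>, and the
  unit circle pulls back to the conic \<open>2 X Z + X Y + Y Z = 0\<close>. Prescribing two more points on this
  conic is a homogeneous linear system of two equations in \<open>1 / k\<close>, \<open>1 / l\<close>, \<open>1 / m\<close>; its solution, a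
  cross product, has components of one sign because the extreme points are in convex position.
\<close>

section \<open>Signed areas and barycentric coordinates\<close>

definition tdet :: "real ^ 2 \<Rightarrow> real ^ 2 \<Rightarrow> real ^ 2 \<Rightarrow> real" where
  "tdet p q r = (q$1 - p$1) * (r$2 - p$2) - (q$2 - p$2) * (r$1 - p$1)"

lemma orientation_eq_sgn_tdet: "orientation p q r = sgn (tdet p q r)"
  by (simp add: orientation_def tdet_def det_2)

lemma tdet_cyclic: "tdet q r p = tdet p q r"
  by (simp add: tdet_def algebra_simps)

lemma tdet_swap: "tdet q p r = - tdet p q r" "tdet p r q = - tdet p q r" "tdet r q p = - tdet p q r"
  by (simp_all add: tdet_def algebra_simps)

lemma tdet_degenerate [simp]: "tdet p p q = 0" "tdet p q p = 0" "tdet q p p = 0"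
  by (simp_all add: tdet_def)

lemma tdet_affine:
  assumes "u + v = 1"
  shows "tdet (u *\<^sub>R x + v *\<^sub>R y) q r = u * tdet x q r + v * tdet y q r"
    and "tdet p (u *\<^sub>R x + v *\<^sub>R y) r = u * tdet p x r + v * tdet p y r"
    and "tdet p q (u *\<^sub>R x + v *\<^sub>R y) = u * tdet p q x + v * tdet p q y"
proof -
  have v: "v = 1 - u" using assms by simp
  show "tdet (u *\<^sub>R x + v *\<^sub>R y) q r = u * tdet x q r + v * tdet y q r"
    and "tdet p (u *\<^sub>R x + v *\<^sub>R y) r = u * tdet p x r + v * tdet p y r"
    and "tdet p q (u *\<^sub>R x + v *\<^sub>R y) = u * tdet p q x + v * tdet p q y"
    by (simp_all add: tdet_def v algebra_simps)
qed

lemma collinear_if_tdet_eq_0: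
  assumes "tdet p q r = 0"
  shows "collinear {p, q, r}"
proof (cases "p = q")
  case True
  then show ?thesis by simp
next
  case False
  define A B where "A = q - p" and "B = r - p"
  have eq: "A$1 * B$2 = A$2 * B$1"
    using assms by (simp add: tdet_def A_def B_def)
  from False have "A$1 \<noteq> 0 \<or> A$2 \<noteq> 0"
    by (auto simp: A_def vec_eq_iff forall_2)
  then have "\<exists>t. B = t *\<^sub>R A"
  proof
    assume "A$1 \<noteq> 0"
    with eq have "B = (B$1 / A$1) *\<^sub>R A"
      by (simp add: vec_eq_iff forall_2 field_simps)
    then show ?thesis ..
  next
    assume "A$2 \<noteq> 0"
    with eq have "B = (B$2 / A$2) *\<^sub>R A"
      by (simp add: vec_eq_iff forall_2 field_simps)
    then show ?thesis ..
  qed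
  then have "collinear {0, q - p, r - p}"
    by (auto simp: collinear_lemma A_def B_def)
  then have "collinear {q, p, r}"
    using collinear_3[of q p r] by simp
  then show ?thesis by (simp add: insert_commute)
qed

lemma simple_configuration_tdet_nonzero:
  assumes "simple_configuration P" "p \<in> P" "q \<in> P" "r \<in> P" "p \<noteq> q" "p \<noteq> r" "q \<noteq> r"
  shows "tdet p q r \<noteq> 0"
  using assms collinear_if_tdet_eq_0[of p q r] unfolding simple_configuration_def by metis

lemma eq_scaleR_if_scaleR_eq:
  fixes x y :: "'a :: real_vector"
  assumes "s *\<^sub>R x = y" "s > 0"
  shows "x = (1 / s) *\<^sub>R y"
  using assms by auto

text \<open>By Cramer's rule, the three determinants containing \<open>x\<close>, divided by
  \<open>tdet a b c\<close>, are the barycentric coordinates of \<open>x\<close> with respect to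
  \<open>a\<close>, \<open>b\<close>, \<open>c\<close>.\<close>

lemma in_convex_hull_if_tdet:
  assumes "tdet a b c > 0" "tdet x b c \<ge> 0" "tdet a x c \<ge> 0" "tdet a b x \<ge> 0"
  shows "x \<in> convex hull {a, b, c}"
proof -
  let ?D = "tdet a b c"
  have sum: "tdet x b c + tdet a x c + tdet a b x = ?D"
    by (simp add: tdet_def algebra_simps)
  have "?D *\<^sub>R x = tdet x b c *\<^sub>R a + tdet a x c *\<^sub>R b + tdet a b x *\<^sub>R c"
    by (simp add: vec_eq_iff forall_2 tdet_def algebra_simps)
  then have "x = (1 / ?D) *\<^sub>R (tdet x b c *\<^sub>R a + tdet a x c *\<^sub>R b + tdet a b x *\<^sub>R c)"
    using assms(1) by (intro eq_scaleR_if_scaleR_eq)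
  also have "\<dots> = (tdet x b c / ?D) *\<^sub>R a + (tdet a x c / ?D) *\<^sub>R b + (tdet a b x / ?D) *\<^sub>R c"
    by (simp add: scaleR_add_right)
  finally have x: "x = \<dots>" .
  have "tdet x b c / ?D + tdet a x c / ?D + tdet a b x / ?D = 1"
    using sum assms(1) by (simp add: add_divide_distrib[symmetric])
  with x assms show ?thesis
    unfolding convex_hull_3 by (blast intro: divide_nonneg_pos)
qed

section \<open>Sign patterns of points in convex position\<close>

definition convex_position :: "(real ^ 2) set \<Rightarrow> bool" where
  "convex_position E \<longleftrightarrow>
     (\<forall>p\<in>E. \<forall>q\<in>E. \<forall>r\<in>E. p \<noteq> q \<and> p \<noteq> r \<and> q \<noteq> r \<longrightarrow> tdet p q r \<noteq> 0) \<and>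
     (\<forall>x\<in>E. x \<notin> convex hull (E - {x}))"

text \<open>If no barycentric coordinate of \<open>x\<close> were negative, \<open>x\<close> would
  lie in the triangle \<open>a b c\<close>.\<close>

lemma convex_position_tdet_cases:
  assumes E: "convex_position E" and "a \<in> E" "b \<in> E" "c \<in> E" "x \<in> E"
    and "distinct [a, b, c, x]" and "tdet a b c > 0"
  shows "tdet x b c < 0 \<or> tdet a x c < 0 \<or> tdet a b x < 0"
proof (rule ccontr)
  assume "\<not> ?thesis"
  with assms have "x \<in> convex hull {a, b, c}"
    by (intro in_convex_hull_if_tdet) auto
  moreover have "convex hull {a, b, c} \<subseteq> convex hull (E - {x})"
    using assms by (intro hull_mono) auto
  ultimately show False
    using E \<open>x \<in> E\<close> unfolding convex_position_def by blast
qed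

lemma convex_position_tdet_nonzero:
  assumes "convex_position E" "a \<in> E" "b \<in> E" "c \<in> E" "distinct [a, b, c]"
  shows "tdet a b c \<noteq> 0"
  using assms unfolding convex_position_def by auto

text \<open>The three coordinates of \<open>d\<close> sum to \<open>tdet a b c\<close>, so one of
  the two outer ones is positive. It forces the other to be positive: otherwise \<open>c\<close>
  would lie in the triangle \<open>a b d\<close>, or \<open>a\<close> in the triangle
  \<open>d b c\<close>.\<close>

lemma convex_position_quadrilateral:
  assumes E: "convex_position E" and in_E: "a \<in> E" "b \<in> E" "c \<in> E" "d \<in> E"
    and dist: "distinct [a, b, c, d]" and abc: "tdet a b c > 0" and adc: "tdet a d c < 0"
  shows "tdet d b c > 0" "tdet a b d > 0"
proof -
  have sum: "tdet d b c + tdet a d c + tdet a b d = tdet a b c"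
    by (simp add: tdet_def algebra_simps)
  have nz: "tdet d b c \<noteq> 0" "tdet a b d \<noteq> 0"
    using convex_position_tdet_nonzero[OF E] dist in_E by auto
  have 1: "tdet a b d > 0 \<Longrightarrow> tdet c b d < 0 \<or> tdet a c d < 0"
    using convex_position_tdet_cases[OF E, of a b d c] dist in_E abc by auto
  have 2: "tdet d b c > 0 \<Longrightarrow> tdet a b c < 0 \<or> tdet d a c < 0 \<or> tdet d b a < 0"
    using convex_position_tdet_cases[OF E, of d b c a] dist in_E by auto
  have s: "tdet c b d = - tdet d b c" "tdet a c d = - tdet a d c"
     "tdet d a c = - tdet a d c" "tdet d b a = - tdet a b d"
    by (simp_all add: tdet_def algebra_simps)
  show "tdet d b c > 0" "tdet a b d > 0"
    using 1 2 nz sum abc adc unfolding s by linarith+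
qed

text \<open>If the line \<open>d e\<close> separated \<open>b\<close> from \<open>c\<close>, then
  \<open>d\<close> would lie in the triangle \<open>b c e\<close> or \<open>e\<close> in the
  triangle \<open>b c d\<close>, depending on which of \<open>b\<close>, \<open>c\<close> is on
  which side.\<close>

lemma convex_position_same_side:
  assumes E: "convex_position E" and in_E: "b \<in> E" "c \<in> E" "d \<in> E" "e \<in> E"
    and dist: "distinct [b, c, d, e]" and bcd: "tdet b c d > 0" and bce: "tdet b c e > 0"
  shows "tdet b d e > 0 \<longleftrightarrow> tdet c d e > 0"
proof -
  have nz: "tdet b d e \<noteq> 0" "tdet c d e \<noteq> 0"
    using convex_position_tdet_nonzero[OF E] dist in_E by auto
  have 1: "tdet d c e < 0 \<or> tdet b d e < 0"
    using convex_position_tdet_cases[OF E, of b c e d] dist in_E bcd bce by auto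
  have 2: "tdet e c d < 0 \<or> tdet b e d < 0"
    using convex_position_tdet_cases[OF E, of b c d e] dist in_E bcd bce by auto
  have s: "tdet d c e = - tdet c d e" "tdet e c d = tdet c d e" "tdet b e d = - tdet b d e"
    by (simp_all add: tdet_def algebra_simps)
  show ?thesis
    using 1 2 nz unfolding s by linarith
qed

text \<open>Once the triangle is oriented counterclockwise, \<open>d\<close> has a negative
  barycentric coordinate; a cyclic rotation of the vertices makes it the middle one.\<close>

lemma convex_position_ear:
  assumes E: "convex_position E" and in_E: "x \<in> E" "y \<in> E" "z \<in> E" "d \<in> E"
    and dist: "distinct [x, y, z, d]"
  obtains a b c where "{a, b, c} = {x, y, z}" "tdet a b c > 0" "tdet a d c < 0"
proof -
  note result = that
  have pos: thesis if "x' \<in> E" "y' \<in> E" "z' \<in> E" "distinct [x', y', z', d]"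
      "{x', y', z'} = {x, y, z}" "tdet x' y' z' > 0" for x' y' z'
  proof -
    have "tdet d y' z' < 0 \<or> tdet x' d z' < 0 \<or> tdet x' y' d < 0"
      using that in_E by (intro convex_position_tdet_cases[OF E])
    then show thesis
    proof (elim disjE)
      assume "tdet d y' z' < 0"
      moreover have "tdet z' x' y' = tdet x' y' z'" "tdet z' d y' = tdet d y' z'"
        by (metis tdet_cyclic)+
      ultimately show thesis
        using that by (intro result[of z' x' y']) auto
    next
      assume "tdet x' d z' < 0"
      then show thesis
        using that by (intro result[of x' y' z'])
    next
      assume "tdet x' y' d < 0"
      moreover have "tdet y' z' x' = tdet x' y' z'" "tdet y' d x' = tdet x' y' d"
        by (metis tdet_cyclic)+
      ultimately show thesis
        using that by (intro result[of y' z' x']) auto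
    qed
  qed
  have "tdet x y z \<noteq> 0"
    using convex_position_tdet_nonzero[OF E] dist in_E by auto
  then consider "tdet x y z > 0" | "tdet x z y > 0"
    using tdet_swap(2)[of x z y] by linarith
  then show thesis
    using pos[of x y z] pos[of x z y] in_E dist by cases auto
qed

section \<open>The weights and the projective map\<close>

text \<open>Division by \<open>(k * x) * (l * y) * (m * z)\<close> turns the conic equation into
  \<open>1 / (k * x) - 2 / (l * y) + 1 / (m * z) = 0\<close>, which is linear in the reciprocals of
  the weights. Here \<open>y\<close> is the negated middle coordinate, so that all the numbers are
  positive.\<close>

lemma projective_weights:
  fixes x y z x' y' z' :: real
  assumes "x > 0" "y > 0" "z > 0" "x' > 0" "y' > 0" "z' > 0"
    and "y * z' > z * y'" "x * z' > z * x'" "x * y' > y * x'"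
  obtains k l m where "k > 0" "l > 0" "m > 0"
    "2 * (k * x) * (m * z) = (k * x) * (l * y) + (l * y) * (m * z)"
    "2 * (k * x') * (m * z') = (k * x') * (l * y') + (l * y') * (m * z')"
proof
  \<comment> \<open>Twice the reciprocals of the components of the cross product of
    \<open>(1 / x, - 2 / y, 1 / z)\<close> and \<open>(1 / x', - 2 / y', 1 / z')\<close>. The last
    three hypotheses make these components positive.\<close>
  let ?k = "y * y' * z * z' / (y * z' - z * y')"
  let ?l = "2 * x * x' * z * z' / (x * z' - z * x')"
  let ?m = "x * x' * y * y' / (x * y' - y * x')"
  show "?k > 0" "?l > 0" "?m > 0" using assms by simp_all
  have nz: "y * z' - z * y' \<noteq> 0" "x * z' - z * x' \<noteq> 0" "x * y' - y * x' \<noteq> 0" using assms by auto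
  show "2 * (?k * x) * (?m * z) = (?k * x) * (?l * y) + (?l * y) * (?m * z)"
    using nz by (simp add: divide_simps) algebra
  show "2 * (?k * x') * (?m * z') = (?k * x') * (?l * y') + (?l * y') * (?m * z')"
    using nz by (simp add: divide_simps) algebra
qed

text \<open>The left side is the determinant of the unnormalized barycentric coordinates of
  \<open>p\<close>, \<open>q\<close>, \<open>r\<close>. These arise from the homogeneous coordinates
  by the adjugate of the 3 by 3 matrix of \<open>a\<close>, \<open>b\<close>, \<open>c\<close>, and
  the adjugate has the squared determinant.\<close>

lemma tdet_adjugate:
  "tdet p b c * (tdet a q c * tdet a b r - tdet a b q * tdet a r c)
    - tdet a p c * (tdet q b c * tdet a b r - tdet a b q * tdet r b c)
    + tdet a b p * (tdet q b c * tdet a r c - tdet a q c * tdet r b c)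
   = (tdet a b c)\<^sup>2 * tdet p q r"
  unfolding tdet_def by algebra

text \<open>The denominator \<open>X + Y + Z\<close> is affine, so its positivity at the extreme
  points spreads to their convex hull and hence to \<open>P\<close>; the map to the circle is then
  defined on all of \<open>P\<close>.\<close>

lemma inscribable_if_projective_weights:
  assumes fin: "finite P" and simple: "simple_configuration P"
    and in_P: "a \<in> P" "b \<in> P" "c \<in> P" and abc: "tdet a b c > 0"
    and pos: "k > 0" "l > 0" "m > 0"
    and ext: "\<And>e X Y Z. e \<in> extreme_points P \<Longrightarrow> X = k * tdet e b c \<Longrightarrow> Y = l * tdet a e c
      \<Longrightarrow> Z = m * tdet a b e \<Longrightarrow> X + Y + Z > 0 \<and> 2 * X * Z + X * Y + Y * Z = 0"
  shows "inscribable P"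
proof -
  let ?E = "extreme_points P"
  define X Y Z where "X p = k * tdet p b c" and "Y p = l * tdet a p c" and "Z p = m * tdet a b p"
    for p
  define S where "S p = X p + Y p + Z p" for p
  define F :: "real ^ 2 \<Rightarrow> real ^ 2" where "F p = (1 / S p) *\<^sub>R vector [X p - Z p, Y p]" for p

  have ext_S: "S e > 0" and ext_conic: "2 * X e * Z e + X e * Y e + Y e * Z e = 0"
    if "e \<in> ?E" for e
    using ext[OF that, of "X e" "Y e" "Z e"] by (auto simp: X_def Y_def Z_def S_def)
  have affine: "X (u *\<^sub>R x + v *\<^sub>R y) = u * X x + v * X y"
    "Y (u *\<^sub>R x + v *\<^sub>R y) = u * Y x + v * Y y"
    "Z (u *\<^sub>R x + v *\<^sub>R y) = u * Z x + v * Z y" if "u + v = 1" for u v x y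
    by (simp_all add: X_def Y_def Z_def tdet_affine[OF that] algebra_simps)
  have SF: "S p *\<^sub>R F p = vector [X p - Z p, Y p]" if "S p > 0" for p
    using that by (simp add: F_def)

  \<comment> \<open>\<open>F\<close> sends a convex combination of \<open>x\<close> and
    \<open>y\<close> to one of \<open>F x\<close> and \<open>F y\<close>, with weights rescaled by
    \<open>S\<close>. Thus positivity of \<open>S\<close> and membership in the image hull are
    carried along together.\<close>
  have "convex {p. S p > 0 \<and> F p \<in> convex hull (F ` ?E)}" (is "convex ?C")
  proof (rule convexI)
    fix x y u v assume x: "x \<in> ?C" and y: "y \<in> ?C" and uv: "0 \<le> u" "0 \<le> v" "u + v = (1::real)"
    let ?w = "u *\<^sub>R x + v *\<^sub>R y"
    have S: "S ?w = u * S x + v * S y"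
      by (simp add: S_def affine[OF uv(3)] algebra_simps)
    have "u > 0 \<or> v > 0" using uv by linarith
    then have Spos: "S ?w > 0"
      unfolding S using x y uv(1,2) by (auto intro: add_pos_nonneg add_nonneg_pos)
    have "S ?w *\<^sub>R F ?w = u *\<^sub>R (S x *\<^sub>R F x) + v *\<^sub>R (S y *\<^sub>R F y)"
      unfolding SF[OF Spos] using x y
      by (simp add: SF affine[OF uv(3)] vec_eq_iff forall_2 algebra_simps)
    then have "F ?w = (1 / S ?w) *\<^sub>R (u *\<^sub>R (S x *\<^sub>R F x) + v *\<^sub>R (S y *\<^sub>R F y))"
      using Spos by (intro eq_scaleR_if_scaleR_eq)
    then have "F ?w = (u * S x / S ?w) *\<^sub>R F x + (v * S y / S ?w) *\<^sub>R F y"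
      by (simp add: scaleR_add_right)
    moreover have "u * S x / S ?w + v * S y / S ?w = 1"
      using Spos by (simp add: S add_divide_distrib[symmetric])
    moreover have "u * S x / S ?w \<ge> 0" "v * S y / S ?w \<ge> 0"
      using x y uv(1,2) Spos by simp_all
    ultimately have "F ?w \<in> convex hull (F ` ?E)"
      using x y convexD[OF convex_convex_hull, of "F x" "F ` ?E" "F y"] by auto
    with Spos show "?w \<in> ?C" by simp
  qed
  moreover have "?E \<subseteq> ?C"
    using ext_S by (auto intro: hull_inc)
  ultimately have "convex hull ?E \<subseteq> ?C"
    by (rule hull_minimal[rotated])
  moreover have "convex hull P = convex hull ?E"
    unfolding extreme_points_def using fin
    by (intro Krein_Milman_Minkowski) (auto intro: finite_imp_compact_convex_hull)
  ultimately have P_C: "P \<subseteq> ?C"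
    using hull_subset[of P convex] by blast

  have F_coord: "F p $ 1 = (X p - Z p) / S p" "F p $ 2 = Y p / S p" for p
    by (simp_all add: F_def)
  \<comment> \<open>The factor 2 is the determinant of the linear map \<open>(X, Y, Z)\<close> to
    \<open>(X - Z, Y, X + Y + Z)\<close>, the factor \<open>k * l * m\<close> comes from the
    rescaling, the square from the adjugate, and the denominator from normalizing homogeneous
    coordinates.\<close>
  have tdet_F: "tdet (F p) (F q) (F r) = 2 * k * l * m * (tdet a b c)\<^sup>2 / (S p * S q * S r) * tdet p q r"
    if "p \<in> P" "q \<in> P" "r \<in> P" for p q r
  proof -
    have S: "S p \<noteq> 0" "S q \<noteq> 0" "S r \<noteq> 0" using P_C that by auto
    have XZ: "X p - Z p = F p $ 1 * S p" "X q - Z q = F q $ 1 * S q" "X r - Z r = F r $ 1 * S r"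
      and Y: "Y p = F p $ 2 * S p" "Y q = F q $ 2 * S q" "Y r = F r $ 2 * S r"
      using S by (simp_all add: F_coord)
    have "tdet (F p) (F q) (F r) * (S p * S q * S r) =
        (X p - Z p) * (Y q * S r - S q * Y r) - Y p * ((X q - Z q) * S r - S q * (X r - Z r))
        + S p * ((X q - Z q) * Y r - Y q * (X r - Z r))"
      unfolding XZ Y tdet_def by (simp add: algebra_simps)
    also have "\<dots> = 2 * (X p * (Y q * Z r - Z q * Y r) - Y p * (X q * Z r - Z q * X r)
        + Z p * (X q * Y r - Y q * X r))"
      unfolding S_def by (simp add: algebra_simps)
    also have "\<dots> = 2 * k * l * m * (tdet p b c * (tdet a q c * tdet a b r - tdet a b q * tdet a r c)
        - tdet a p c * (tdet q b c * tdet a b r - tdet a b q * tdet r b c)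
        + tdet a b p * (tdet q b c * tdet a r c - tdet a q c * tdet r b c))"
      unfolding X_def Y_def Z_def by (simp add: algebra_simps)
    also have "\<dots> = 2 * k * l * m * ((tdet a b c)\<^sup>2 * tdet p q r)"
      unfolding tdet_adjugate ..
    finally show ?thesis using S by (simp add: field_simps)
  qed
  have orient: "orientation (F p) (F q) (F r) = orientation p q r"
    if "p \<in> P" "q \<in> P" "r \<in> P" for p q r
  proof -
    have "2 * k * l * m * (tdet a b c)\<^sup>2 / (S p * S q * S r) > 0"
      using P_C that pos abc by (auto intro!: divide_pos_pos mult_pos_pos)
    then show ?thesis
      unfolding orientation_eq_sgn_tdet tdet_F[OF that] sgn_mult[of _ "tdet p q r"]
      by (simp only: sgn_pos mult_1_left)
  qed

  have "inj_on F P"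
  proof (rule inj_onI, rule ccontr)
    fix p q assume pq: "p \<in> P" "q \<in> P" "F p = F q" "p \<noteq> q"
    \<comment> \<open>One of \<open>a\<close>, \<open>b\<close>, \<open>c\<close> differs from both
      \<open>p\<close> and \<open>q\<close>. With it they form a triple of nonzero orientation,
      which \<open>F p = F q\<close> would degenerate.\<close>
    have "a \<noteq> b" "a \<noteq> c" "b \<noteq> c" using abc by auto
    then obtain r where r: "r \<in> P" "r \<noteq> p" "r \<noteq> q" using in_P by metis
    have "tdet p q r \<noteq> 0"
      using simple_configuration_tdet_nonzero[OF simple] pq r by metis
    moreover have "orientation p q r = 0"
      using orient[OF pq(1,2) r(1)] pq(3) by (simp add: orientation_eq_sgn_tdet)
    ultimately show False by (simp add: orientation_eq_sgn_tdet sgn_zero_iff)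
  qed
  then have "same_order_type P (F ` P)"
    unfolding same_order_type_def using orient by (blast intro: inj_on_imp_bij_betw)
  moreover have "inscribed (F ` P)"
  proof -
    have "?E \<subseteq> P"
      unfolding extreme_points_def by (auto dest: extreme_point_of_convex_hull)
    then have "convex hull (F ` P) = convex hull (F ` ?E)"
      using P_C by (intro antisym hull_mono hull_minimal) auto
    then have "extreme_points (F ` P) \<subseteq> F ` ?E"
      unfolding extreme_points_def[of "F ` P"] by (auto dest: extreme_point_of_convex_hull)
    moreover have "F e \<in> sphere 0 1" if "e \<in> ?E" for e
    proof -
      \<comment> \<open>The two sides differ by twice the conic form
        \<open>2 X Z + X Y + Y Z\<close>.\<close>
      have "(X e - Z e)\<^sup>2 + (Y e)\<^sup>2 = (S e)\<^sup>2"
        using ext_conic[OF that] unfolding S_def by algebra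
      then have "(F e $ 1)\<^sup>2 + (F e $ 2)\<^sup>2 = 1"
        using ext_S[OF that] by (simp add: F_coord power_divide add_divide_distrib[symmetric])
      then show ?thesis
        by (simp add: norm_vec_def L2_set_def sum_2)
    qed
    ultimately show ?thesis
      unfolding inscribed_def by (meson image_subset_iff order_trans zero_less_one)
  qed
  ultimately show ?thesis
    unfolding inscribable_def using fin by blast
qed

section \<open>Basic facts on extreme points\<close>

lemma inscribed_if_card_extreme_points_le_2:
  assumes fin: "finite (extreme_points P)" and card: "card (extreme_points P) \<le> 2"
  shows "inscribed P"
proof -
  \<comment> \<open>Padding to two distinct points gives the circle with diameter \<open>x y\<close>
    a positive radius.\<close>
  have "\<exists>x y. extreme_points P \<subseteq> {x, y} \<and> x \<noteq> y"
  proof -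
    consider "card (extreme_points P) = 0" | "card (extreme_points P) = 1" | "card (extreme_points P) = 2"
      using card by linarith
    then show ?thesis
    proof cases
      case 1
      then have "extreme_points P \<subseteq> {0, axis 1 1}" using fin by simp
      moreover have "0 \<noteq> (axis 1 1 :: real ^ 2)" by (metis axis_eq_0_iff zero_neq_one)
      ultimately show ?thesis by blast
    next
      case 2
      then obtain x where "extreme_points P = {x}" by (auto simp: card_1_singleton_iff)
      moreover have "x \<noteq> x + axis 1 1" by simp
      ultimately show ?thesis by blast
    next
      case 3
      then show ?thesis by (auto simp: card_2_iff)
    qed
  qed
  then obtain x y where xy: "extreme_points P \<subseteq> {x, y}" "x \<noteq> y" by blast
  then have "extreme_points P \<subseteq> sphere (midpoint x y) (dist x y / 2)"
    by (auto simp: dist_midpoint)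
  then show ?thesis
    unfolding inscribed_def using xy(2) by (intro exI[of _ "midpoint x y"] exI[of _ "dist x y / 2"]) simp
qed

text \<open>An extreme point of the hull of \<open>P\<close> stays extreme in any smaller hull
  containing it, and so is one of the points generating that hull.\<close>

lemma convex_position_extreme_points:
  assumes fin: "finite P" and simple: "simple_configuration P"
  shows "convex_position (extreme_points P)"
proof -
  have sub: "extreme_points P \<subseteq> P"
    unfolding extreme_points_def by (auto dest: extreme_point_of_convex_hull)
  have "x \<notin> convex hull (extreme_points P - {x})" if "x \<in> extreme_points P" for x
  proof
    assume x: "x \<in> convex hull (extreme_points P - {x})"
    have "x extreme_point_of (convex hull P)"
      using that by (simp add: extreme_points_def)
    moreover have "convex hull (extreme_points P - {x}) \<subseteq> convex hull P"
      using sub by (intro hull_mono) blast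
    ultimately have "x extreme_point_of (convex hull (extreme_points P - {x}))"
      using x unfolding extreme_point_of_def by blast
    then show False
      using extreme_point_of_convex_hull by blast
  qed
  moreover have "tdet p q r \<noteq> 0"
    if "p \<in> extreme_points P" "q \<in> extreme_points P" "r \<in> extreme_points P"
      "p \<noteq> q \<and> p \<noteq> r \<and> q \<noteq> r" for p q r
    using simple_configuration_tdet_nonzero[OF simple] sub that by (metis subsetD)
  ultimately show ?thesis
    unfolding convex_position_def by blast
qed

section \<open>Inscribing triangles, quadrilaterals and pentagons\<close>

text \<open>At \<open>a\<close>, \<open>b\<close>, \<open>c\<close> two of the three coordinates
  vanish, so these points satisfy the conic equation for any weights. At the others, positivity of
  the denominator follows from the equation and the two outer signs.\<close>

lemma inscribable_if_conic_weights:
  assumes fin: "finite P" and simple: "simple_configuration P"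
    and in_P: "a \<in> P" "b \<in> P" "c \<in> P" and abc: "tdet a b c > 0"
    and pos: "k > 0" "l > 0" "m > 0"
    and other: "\<And>e. e \<in> extreme_points P - {a, b, c} \<Longrightarrow> tdet e b c > 0 \<and> tdet a b e > 0 \<and>
      2 * (k * tdet e b c) * (m * tdet a b e) =
      (k * tdet e b c) * (l * - tdet a e c) + (l * - tdet a e c) * (m * tdet a b e)"
  shows "inscribable P"
proof (rule inscribable_if_projective_weights[OF fin simple in_P abc pos])
  fix e X Y Z
  assume e: "e \<in> extreme_points P"
    and XYZ: "X = k * tdet e b c" "Y = l * tdet a e c" "Z = m * tdet a b e"
  show "X + Y + Z > 0 \<and> 2 * X * Z + X * Y + Y * Z = 0"
  proof (cases "e \<in> {a, b, c}")
    case True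
    then show ?thesis using abc pos XYZ by auto
  next
    case False
    then have conic: "2 * X * Z + X * Y + Y * Z = 0" and "X > 0" "Z > 0"
      using other[of e] e pos by (simp_all add: XYZ)
    \<comment> \<open>Expanding the left side gives \<open>X\<^sup>2 + Z\<^sup>2\<close> plus the
      conic form, which is zero.\<close>
    have "(X + Z) * (X + Y + Z) = X\<^sup>2 + Z\<^sup>2"
      using conic by algebra
    also have "\<dots> > 0" using \<open>X > 0\<close> by (simp add: add_pos_nonneg)
    finally show ?thesis
      using conic \<open>X > 0\<close> \<open>Z > 0\<close> by (simp add: zero_less_mult_iff)
  qed
qed

text \<open>These are the 2 by 2 minors of the barycentric coordinates of \<open>d\<close> and
  \<open>e\<close>. Each has a sign determined by the side of the line \<open>d e\<close> on which
  one vertex of the triangle lies.\<close>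

lemma tdet_pluecker:
  "tdet a b d * tdet a e c - tdet a d c * tdet a b e = - (tdet a b c * tdet a d e)"
  "tdet d b c * tdet a b e - tdet a b d * tdet e b c = - (tdet a b c * tdet b d e)"
  "tdet a d c * tdet e b c - tdet d b c * tdet a e c = - (tdet a b c * tdet c d e)"
  unfolding tdet_def by algebra+

text \<open>Since \<open>d\<close> and \<open>e\<close> both lie beyond \<open>a c\<close>, the line
  \<open>d e\<close> leaves \<open>a\<close>, \<open>b\<close>, \<open>c\<close> on one side. The
  three minors therefore have the common sign that \<open>projective_weights\<close> needs.\<close>

lemma inscribable_if_pentagon:
  assumes fin: "finite P" and simple: "simple_configuration P"
    and ext: "extreme_points P = {a, b, c, d, e}" and dist: "distinct [a, b, c, d, e]"
    and abc: "tdet a b c > 0" and adc: "tdet a d c < 0" and aec: "tdet a e c < 0"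
  shows "inscribable P"
proof -
  let ?E = "extreme_points P"
  note E = convex_position_extreme_points[OF fin simple]
  have in_P: "a \<in> P" "b \<in> P" "c \<in> P"
    using ext extreme_point_of_convex_hull unfolding extreme_points_def by blast+
  \<comment> \<open>The roles of \<open>d\<close> and \<open>e\<close> are symmetric, so the triple
    \<open>a d e\<close> may be taken clockwise.\<close>
  have *: "inscribable P" if ext: "?E = {a, b, c, d, e}" and dist: "distinct [a, b, c, d, e]"
    and adc: "tdet a d c < 0" and aec: "tdet a e c < 0" and ade: "tdet a d e < 0" for d e
  proof -
    have d: "tdet d b c > 0" "tdet a b d > 0"
      using convex_position_quadrilateral[OF E, of a b c d] ext dist abc adc by auto
    have e: "tdet e b c > 0" "tdet a b e > 0"
      using convex_position_quadrilateral[OF E, of a b c e] ext dist abc aec by auto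
    have "tdet b c d > 0" "tdet b c e > 0"
      using d e by (simp_all add: tdet_cyclic)
    moreover have "a \<in> ?E" "b \<in> ?E" "c \<in> ?E" "d \<in> ?E" "e \<in> ?E"
      "distinct [a, b, d, e]" "distinct [b, c, d, e]"
      using ext dist by auto
    \<comment> \<open>Both \<open>d\<close> and \<open>e\<close> lie to the left of
      \<open>a b\<close> and of \<open>b c\<close>, so the line \<open>d e\<close> separates neither
      pair.\<close>
    ultimately have "tdet a d e > 0 \<longleftrightarrow> tdet b d e > 0" "tdet b d e > 0 \<longleftrightarrow> tdet c d e > 0"
      using convex_position_same_side[OF E] d(2) e(2) by blast+
    moreover have "tdet b d e \<noteq> 0" "tdet c d e \<noteq> 0"
      using convex_position_tdet_nonzero[OF E] ext dist by auto
    ultimately have "tdet b d e < 0" "tdet c d e < 0"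
      using ade by linarith+
    then have "tdet a b c * tdet a d e < 0" "tdet a b c * tdet b d e < 0"
      "tdet a b c * tdet c d e < 0"
      using abc ade by (simp_all add: mult_pos_neg)
    then have "- tdet a d c * tdet a b e > tdet a b d * - tdet a e c"
      "tdet d b c * tdet a b e > tdet a b d * tdet e b c"
      "tdet d b c * - tdet a e c > - tdet a d c * tdet e b c"
      using tdet_pluecker[where a = a and b = b and c = c and d = d and e = e] by simp_all
    with d e adc aec obtain k l m where pos: "k > 0" "l > 0" "m > 0"
      and conic: "2 * (k * tdet d b c) * (m * tdet a b d) =
        (k * tdet d b c) * (l * - tdet a d c) + (l * - tdet a d c) * (m * tdet a b d)"
        "2 * (k * tdet e b c) * (m * tdet a b e) =
        (k * tdet e b c) * (l * - tdet a e c) + (l * - tdet a e c) * (m * tdet a b e)"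
      using projective_weights[of "tdet d b c" "- tdet a d c" "tdet a b d"
          "tdet e b c" "- tdet a e c" "tdet a b e"] by (metis neg_0_less_iff_less)
    show ?thesis
    proof (rule inscribable_if_conic_weights[OF fin simple in_P abc pos])
      fix x assume "x \<in> ?E - {a, b, c}"
      then have "x = d \<or> x = e" using ext by blast
      then show "tdet x b c > 0 \<and> tdet a b x > 0 \<and> 2 * (k * tdet x b c) * (m * tdet a b x) =
        (k * tdet x b c) * (l * - tdet a x c) + (l * - tdet a x c) * (m * tdet a b x)"
        using d e conic by blast
    qed
  qed
  have "tdet a d e \<noteq> 0"
    using convex_position_tdet_nonzero[OF E] ext dist by auto
  then consider "tdet a d e < 0" | "tdet a e d < 0"
    using tdet_swap(2)[of a d e] by linarith
  then show ?thesis
  proof cases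
    case 1
    then show ?thesis using *[OF ext dist adc aec] by blast
  next
    case 2
    have "?E = {a, b, c, e, d}" "distinct [a, b, c, e, d]" using ext dist by auto
    then show ?thesis using *[of e d] 2 adc aec by blast
  qed
qed

lemma inscribable_if_quadrilateral:
  assumes fin: "finite P" and simple: "simple_configuration P"
    and ext: "extreme_points P = {a, b, c, d}" and dist: "distinct [a, b, c, d]"
    and abc: "tdet a b c > 0" and adc: "tdet a d c < 0"
  shows "inscribable P"
proof -
  note E = convex_position_extreme_points[OF fin simple]
  have in_P: "a \<in> P" "b \<in> P" "c \<in> P"
    using ext extreme_point_of_convex_hull unfolding extreme_points_def by blast+
  have d: "tdet d b c > 0" "tdet a b d > 0"
    using convex_position_quadrilateral[OF E, of a b c d] ext dist abc adc by auto
  \<comment> \<open>With \<open>k = m = 1\<close> the single conic condition, at \<open>d\<close>,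
    reads \<open>l * q = 2 * tdet d b c * tdet a b d\<close> and is solved for
    \<open>l\<close>.\<close>
  define q where "q = - tdet a d c * (tdet d b c + tdet a b d)"
  define l where "l = 2 * tdet d b c * tdet a b d / q"
  have "q > 0"
    unfolding q_def using d adc by (intro mult_pos_pos) auto
  then have "l > 0" and "l * q = 2 * tdet d b c * tdet a b d"
    unfolding l_def using d by simp_all
  then show ?thesis
    using d ext by (intro inscribable_if_conic_weights[OF fin simple in_P abc, of 1 l 1])
      (auto simp: q_def algebra_simps)
qed

text \<open>No extreme point remains to constrain the conic, so unit weights suffice.\<close>

lemma inscribable_if_triangle:
  assumes fin: "finite P" and simple: "simple_configuration P"
    and ext: "extreme_points P = {a, b, c}" and abc: "tdet a b c > 0"
  shows "inscribable P"
proof -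
  have "a \<in> P" "b \<in> P" "c \<in> P"
    using ext extreme_point_of_convex_hull unfolding extreme_points_def by blast+
  then show ?thesis
    using ext by (intro inscribable_if_conic_weights[OF fin simple _ _ _ abc, of 1 1 1]) auto
qed

section \<open>Case distinction on the number of extreme points\<close>

theorem proposition1p3:
  fixes P :: "(real ^ 2) set"
  assumes "finite P"
    and "simple_configuration P"
    and "card (extreme_points P) \<le> 5"
  shows "inscribable P"
proof -
  let ?E = "extreme_points P"
  note E = convex_position_extreme_points[OF assms(1,2)]
  have "?E \<subseteq> P"
    unfolding extreme_points_def by (auto dest: extreme_point_of_convex_hull)
  then have fin: "finite ?E" using assms(1) by (rule finite_subset)
  then obtain xs where xs: "set xs = ?E" "distinct xs" "length xs = card ?E"
    by (metis distinct_card finite_distinct_list)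
  consider "card ?E \<le> 2" | "length xs = 3" | "length xs = 4" | "length xs = 5"
    using assms(3) xs(3) by linarith
  then show ?thesis
  proof cases
    case 1
    have "same_order_type P P"
      unfolding same_order_type_def by (intro exI[of _ id]) simp
    moreover have "inscribed P"
      using fin 1 by (rule inscribed_if_card_extreme_points_le_2)
    ultimately show ?thesis
      unfolding inscribable_def using assms(1) by blast
  next
    case 2
    then obtain a b c where "xs = [a, b, c]"
      by (auto simp: numeral_eq_Suc length_Suc_conv)
    then have abc: "?E = {a, b, c}" "distinct [a, b, c]" using xs by auto
    then have "tdet a b c \<noteq> 0"
      using convex_position_tdet_nonzero[OF E] by auto
    then consider "tdet a b c > 0" | "tdet a c b > 0"
      using tdet_swap(2)[of a b c] by linarith
    then show ?thesis
      using inscribable_if_triangle[OF assms(1,2), of a b c]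
        inscribable_if_triangle[OF assms(1,2), of a c b] abc(1)
      by cases (auto simp: insert_commute)
  next
    case 3
    then obtain x y z d where "xs = [x, y, z, d]"
      by (auto simp: numeral_eq_Suc length_Suc_conv)
    then have ext: "?E = {x, y, z, d}" "distinct [x, y, z, d]" using xs by auto
    obtain a b c where abc: "{a, b, c} = {x, y, z}" "tdet a b c > 0" "tdet a d c < 0"
      by (rule convex_position_ear[OF E, of x y z d]) (use ext in auto)
    have "a \<noteq> b" "a \<noteq> c" "b \<noteq> c" using abc(2) by auto
    moreover have "d \<notin> {a, b, c}" using abc(1) ext(2) by auto
    moreover have "?E = insert d {a, b, c}" unfolding ext(1) abc(1) by auto
    then have "?E = {a, b, c, d}" by auto
    ultimately show ?thesis
      using inscribable_if_quadrilateral[OF assms(1,2), of a b c d] abc(2,3) by auto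
  next
    case 4
    then obtain x y z d e where "xs = [x, y, z, d, e]"
      by (auto simp: numeral_eq_Suc length_Suc_conv)
    then have ext: "?E = {x, y, z, d, e}" "distinct [x, y, z, d, e]" using xs by auto
    \<comment> \<open>The relabelling places only \<open>d\<close> beyond the line
      \<open>a c\<close>; the side of \<open>e\<close> is distinguished below.\<close>
    obtain a b c where abc: "{a, b, c} = {x, y, z}" "tdet a b c > 0" "tdet a d c < 0"
      by (rule convex_position_ear[OF E, of x y z d]) (use ext in auto)
    have "a \<noteq> b" "a \<noteq> c" "b \<noteq> c" using abc(2) by auto
    moreover have "d \<notin> {a, b, c}" "e \<notin> {a, b, c}" using abc(1) ext(2) by auto
    ultimately have dist: "distinct [a, b, c, d, e]" using ext(2) by auto
    have "?E = insert d (insert e {a, b, c})" unfolding ext(1) abc(1) by auto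
    then have ext_abc: "?E = {a, b, c, d, e}" by auto
    have "tdet a e c \<noteq> 0"
      using ext_abc convex_position_tdet_nonzero[OF E] dist by auto
    then consider "tdet a e c < 0" | "tdet c e a < 0"
      using tdet_swap(3)[of a e c] by linarith
    then show ?thesis
    proof cases
      case 1
      then show ?thesis
        using inscribable_if_pentagon[OF assms(1,2) ext_abc dist] abc by blast
    next
      case 2
      \<comment> \<open>The line \<open>a c\<close> separates \<open>d\<close> from \<open>b\<close> and \<open>e\<close>, so \<open>d\<close> takes over the role of \<open>b\<close>.\<close>
      have "?E = {c, d, a, b, e}" "distinct [c, d, a, b, e]" using ext_abc dist by auto
      moreover have "tdet c d a > 0" "tdet c b a < 0"
        using abc(2,3) tdet_swap(3)[of a d c] tdet_swap(3)[of a b c] by auto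
      ultimately show ?thesis
        using inscribable_if_pentagon[OF assms(1,2)] 2 by blast
    qed
  qed
qed

end
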